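(* Let $b\in\mathbb{C}$ be non-zero and let $\mathbb{K}$ be the $\mathbb{C}$-algebra of hybrid numbers, with the weak Hopf algebra structure (depending on $b$) described in the context. Then the space $I^L(\mathbb{K})$ of left integrals in $\mathbb{K}$ is the $\mathbb{C}$-linear span $$I^{L}(\mathbb{K})=\mathbb{C}\left\langle \left(\tfrac1b+i\right)\mu-\nu+1,\ \ -\frac{1-2b(b-i)}{2b^2}\,\mu+\frac{1+ib}{b}\,\nu+g\right\rangle .$$
   Context: All vector spaces, linear maps and tensor products are over $\mathbb{C}$; $i$ is the imaginary unit. Hybrid numbers: $\mathbb{K}$ is the 4-dimensional associative unital $\mathbb{C}$-algebra with basis $1,g,\mu,\nu$ (unit $1$) and multiplication $g^2=-1$, $\mu^2=0$, $\nu^2=1$, $g\mu=1-\nu$, $\mu g=1+\nu$, $g\nu=\mu+g$, $\nu g=-\mu-g$, $\mu\nu=-\mu$, $\nu\mu=\mu$. Weak Hopf algebra structure on $\mathbb{K}$ (all maps linear): $\Delta(1)=\tfrac12\, 1\otimes 1-\tfrac12\,\mu\otimes\mu-\tfrac i2\,\nu\otimes\mu-\tfrac i2\,\mu\otimes\nu+\tfrac12\,\nu\otimes\nu$; $\Delta(g)=-\tfrac12\,\mu\otimes 1-\tfrac i2\,\nu\otimes 1+b\,g\otimes g+b\,\mu\otimes g+ib\,\nu\otimes g-\tfrac12\,1\otimes\mu+b\,g\otimes\mu+b\,\mu\otimes\mu+ib\,\nu\otimes\mu-\tfrac i2\,1\otimes\nu+ib\,g\otimes\nu+ib\,\mu\otimes\nu-b\,\nu\otimes\nu$;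 $\Delta(\mu)=\tfrac1{2b}\,\mu\otimes\mu$; $\Delta(\nu)=-\tfrac i2\,\mu\otimes 1+\tfrac12\,\nu\otimes 1-\tfrac i2\,1\otimes\mu+\tfrac i{2b}\,\mu\otimes\mu+\tfrac12\,1\otimes\nu$; $\varepsilon(1)=2$, $\varepsilon(g)=\tfrac1b$, $\varepsilon(\mu)=2b$, $\varepsilon(\nu)=2ib$; antipode $S(1)=1$, $S(g)=(-1+\tfrac1{2b^2})\mu-i\nu$, $S(\mu)=2b^2g+2b^2\mu+2ib^2\nu$, $S(\nu)=2ib^2g-(i-2ib^2)\mu+(1-2b^2)\nu$. With $\Delta(1)=1_{(1)}\otimes 1_{(2)}$ (Sweedler notation, summation omitted), $\varepsilon_t:\mathbb{K}\to\mathbb{K}$ is $\varepsilon_t(h)=\varepsilon(1_{(1)}h)1_{(2)}$. A left integral in $\mathbb{K}$ is an element $l\in\mathbb{K}$ with $xl=\varepsilon_t(x)l$ for all $x\in\mathbb{K}$; $I^L(\mathbb{K})$ is the space of left integrals. *)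

theory Defs
  imports Complex_Main "HOL-Library.Function_Algebras"
begin

section \<open>The algebra of hybrid numbers\<close>

datatype hbasis = One | G | Mu | Nu

lemma UNIV_hbasis: "UNIV = {One, G, Mu, Nu}"
  using hbasis.exhaust by auto

instance hbasis :: finite
  by standard (simp add: UNIV_hbasis)

text \<open>An element is given by its coordinates with respect to the basis \<open>1, g, \<mu>, \<nu>\<close>.\<close>

datatype hybrid = Hybrid (coord: "hbasis \<Rightarrow> complex")

definition base :: "hbasis \<Rightarrow> hybrid" where
  "base i = Hybrid (\<lambda>k. if k = i then 1 else 0)"

abbreviation g :: hybrid where "g \<equiv> base G"
abbreviation \<mu> :: hybrid where "\<mu> \<equiv> base Mu"
abbreviation \<nu> :: hybrid where "\<nu> \<equiv> base Nu"

definition scale :: "complex \<Rightarrow> hybrid \<Rightarrow> hybrid" (infixr "*\<^sub>C" 75) where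
  "c *\<^sub>C x = Hybrid (\<lambda>k. c * coord x k)"

lemma hybrid_eq_iff: "x = y \<longleftrightarrow> (\<forall>k. coord x k = coord y k)"
  by (cases x; cases y) (simp add: fun_eq_iff)

lemma coord_base: "coord (base i) k = (if k = i then 1 else 0)"
  by (simp add: base_def)

lemma coord_scale: "coord (c *\<^sub>C x) k = c * coord x k"
  by (simp add: scale_def)

instantiation hybrid :: "{ab_group_add, one}"
begin

definition "0 = Hybrid (\<lambda>k. 0)"
definition "x + y = Hybrid (\<lambda>k. coord x k + coord y k)"
definition "- x = Hybrid (\<lambda>k. - coord x k)"
definition "x - y = Hybrid (\<lambda>k. coord x k - coord y k)"
definition "1 = base One"

instance
  by standard
    (simp_all add: zero_hybrid_def plus_hybrid_def uminus_hybrid_def minus_hybrid_def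
      hybrid_eq_iff algebra_simps)

end

lemma coord_add_group [simp]:
  "coord 0 k = 0"
  "coord (x + y) k = coord x k + coord y k"
  "coord (- x) k = - coord x k"
  "coord (x - y) k = coord x k - coord y k"
  by (simp_all add: zero_hybrid_def plus_hybrid_def uminus_hybrid_def minus_hybrid_def)

interpretation hybrid: vector_space scale
  by standard (simp_all add: hybrid_eq_iff coord_scale algebra_simps)

fun mult_base :: "hbasis \<Rightarrow> hbasis \<Rightarrow> hybrid" where
  "mult_base One j = base j"
| "mult_base i One = base i"
| "mult_base G G = - 1"
| "mult_base Mu Mu = 0"
| "mult_base Nu Nu = 1"
| "mult_base G Mu = 1 - \<nu>"
| "mult_base Mu G = 1 + \<nu>"
| "mult_base G Nu = \<mu> + g"
| "mult_base Nu G = - \<mu> - g"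
| "mult_base Mu Nu = - \<mu>"
| "mult_base Nu Mu = \<mu>"

lemma coord_sum: "coord (\<Sum>i\<in>A. f i) k = (\<Sum>i\<in>A. coord (f i) k)"
  by (induction A rule: infinite_finite_induct) simp_all

instantiation hybrid :: ring_1
begin

definition "x * y = (\<Sum>i\<in>UNIV. \<Sum>j\<in>UNIV. (coord x i * coord y j) *\<^sub>C mult_base i j)"

lemma coord_mult:
  "coord (x * y) k = (\<Sum>i\<in>UNIV. \<Sum>j\<in>UNIV. coord x i * coord y j * coord (mult_base i j) k)"
  by (simp add: times_hybrid_def coord_sum coord_scale)

instance
proof
  fix x y z :: hybrid
  note expand = hybrid_eq_iff coord_mult UNIV_hbasis coord_base one_hybrid_def
  have all: "(\<forall>k. P k) \<longleftrightarrow> P One \<and> P G \<and> P Mu \<and> P Nu" for P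
    by (metis hbasis.exhaust)
  show "x * y * z = x * (y * z)"
    unfolding hybrid_eq_iff all by (simp add: expand) (simp add: algebra_simps)
  show "(x + y) * z = x * z + y * z"
    unfolding hybrid_eq_iff all by (simp add: expand) (simp add: algebra_simps)
  show "x * (y + z) = x * y + x * z"
    unfolding hybrid_eq_iff all by (simp add: expand) (simp add: algebra_simps)
  show "1 * x = x"
    unfolding hybrid_eq_iff all by (simp add: expand)
  show "x * 1 = x"
    unfolding hybrid_eq_iff all by (simp add: expand)
  show "(0 :: hybrid) \<noteq> 1"
    by (auto simp: expand)
qed

end

lemma scale_mult:
  "(c *\<^sub>C x) * y = c *\<^sub>C (x * y)" "x * (c *\<^sub>C y) = c *\<^sub>C (x * y)" for x y :: hybrid
  by (simp_all add: hybrid_eq_iff coord_mult coord_scale sum_distrib_left mult_ac)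


section \<open>The weak Hopf algebra structure\<close>

text \<open>The structure depends on a parameter \<open>b\<close> and is meaningful only for \<open>b \<noteq> 0\<close>.\<close>

text \<open>
  The tensor square of the hybrid numbers is modelled by the functions on pairs of basis
  indices: \<open>T i j\<close> is the coefficient of \<open>T\<close> at \<open>base i \<otimes> base j\<close>. Addition is pointwise.
  The pointwise product of \<^theory>\<open>HOL-Library.Function_Algebras\<close> is not the algebra product
  of the tensor square and is not used.
\<close>

type_synonym hybrid2 = "hbasis \<Rightarrow> hbasis \<Rightarrow> complex"

definition tensor :: "hybrid \<Rightarrow> hybrid \<Rightarrow> hybrid2" (infixl "\<otimes>" 78) where
  "x \<otimes> y = (\<lambda>i j. coord x i * coord y j)"

definition scale2 :: "complex \<Rightarrow> hybrid2 \<Rightarrow> hybrid2" (infixr "*\<^sub>T" 75) where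
  "c *\<^sub>T T = (\<lambda>i j. c * T i j)"

lemma tensor_expansion: "T = (\<Sum>i\<in>UNIV. \<Sum>j\<in>UNIV. T i j *\<^sub>T (base i \<otimes> base j))"
proof -
  have app: "(\<Sum>i\<in>A. f i) p = (\<Sum>i\<in>A. f i p)"
    for A :: "hbasis set" and f :: "hbasis \<Rightarrow> 'c \<Rightarrow> 'd::comm_monoid_add" and p
    by (induction A rule: infinite_finite_induct) simp_all
  show ?thesis
  proof (intro ext)
    fix p q
    show "T p q = (\<Sum>i\<in>UNIV. \<Sum>j\<in>UNIV. T i j *\<^sub>T (base i \<otimes> base j)) p q"
      by (cases p; cases q) (simp_all add: app UNIV_hbasis scale2_def tensor_def coord_base)
  qed
qed

fun comult_base :: "complex \<Rightarrow> hbasis \<Rightarrow> hybrid2" where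
  "comult_base b One =
     (1/2) *\<^sub>T (1 \<otimes> 1) - (1/2) *\<^sub>T (\<mu> \<otimes> \<mu>) - (\<i>/2) *\<^sub>T (\<nu> \<otimes> \<mu>) - (\<i>/2) *\<^sub>T (\<mu> \<otimes> \<nu>)
     + (1/2) *\<^sub>T (\<nu> \<otimes> \<nu>)"
| "comult_base b G =
     - ((1/2) *\<^sub>T (\<mu> \<otimes> 1)) - (\<i>/2) *\<^sub>T (\<nu> \<otimes> 1)
     + b *\<^sub>T (g \<otimes> g) + b *\<^sub>T (\<mu> \<otimes> g) + (\<i> * b) *\<^sub>T (\<nu> \<otimes> g)
     - (1/2) *\<^sub>T (1 \<otimes> \<mu>) + b *\<^sub>T (g \<otimes> \<mu>) + b *\<^sub>T (\<mu> \<otimes> \<mu>) + (\<i> * b) *\<^sub>T (\<nu> \<otimes> \<mu>)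
     - (\<i>/2) *\<^sub>T (1 \<otimes> \<nu>) + (\<i> * b) *\<^sub>T (g \<otimes> \<nu>) + (\<i> * b) *\<^sub>T (\<mu> \<otimes> \<nu>) - b *\<^sub>T (\<nu> \<otimes> \<nu>)"
| "comult_base b Mu = (1 / (2 * b)) *\<^sub>T (\<mu> \<otimes> \<mu>)"
| "comult_base b Nu =
     - ((\<i>/2) *\<^sub>T (\<mu> \<otimes> 1)) + (1/2) *\<^sub>T (\<nu> \<otimes> 1)
     - (\<i>/2) *\<^sub>T (1 \<otimes> \<mu>) + (\<i> / (2 * b)) *\<^sub>T (\<mu> \<otimes> \<mu>) + (1/2) *\<^sub>T (1 \<otimes> \<nu>)"

definition comult :: "complex \<Rightarrow> hybrid \<Rightarrow> hybrid2" where
  "comult b x = (\<Sum>i\<in>UNIV. coord x i *\<^sub>T comult_base b i)"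

fun counit_base :: "complex \<Rightarrow> hbasis \<Rightarrow> complex" where
  "counit_base b One = 2"
| "counit_base b G = 1 / b"
| "counit_base b Mu = 2 * b"
| "counit_base b Nu = 2 * \<i> * b"

definition counit :: "complex \<Rightarrow> hybrid \<Rightarrow> complex" where
  "counit b x = (\<Sum>i\<in>UNIV. coord x i * counit_base b i)"

fun antipode_base :: "complex \<Rightarrow> hbasis \<Rightarrow> hybrid" where
  "antipode_base b One = 1"
| "antipode_base b G = (- 1 + 1 / (2 * b\<^sup>2)) *\<^sub>C \<mu> - \<i> *\<^sub>C \<nu>"
| "antipode_base b Mu = (2 * b\<^sup>2) *\<^sub>C g + (2 * b\<^sup>2) *\<^sub>C \<mu> + (2 * \<i> * b\<^sup>2) *\<^sub>C \<nu>"
| "antipode_base b Nu =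
     (2 * \<i> * b\<^sup>2) *\<^sub>C g - (\<i> - 2 * \<i> * b\<^sup>2) *\<^sub>C \<mu> + (1 - 2 * b\<^sup>2) *\<^sub>C \<nu>"

definition antipode :: "complex \<Rightarrow> hybrid \<Rightarrow> hybrid" where
  "antipode b x = (\<Sum>i\<in>UNIV. coord x i *\<^sub>C antipode_base b i)"

text \<open>
  The map \<open>\<epsilon>\<^sub>t(h) = \<epsilon>(1\<^sub>(\<^sub>1\<^sub>)h) 1\<^sub>(\<^sub>2\<^sub>)\<close> in Sweedler notation for \<open>\<Delta>(1) = 1\<^sub>(\<^sub>1\<^sub>) \<otimes> 1\<^sub>(\<^sub>2\<^sub>)\<close>, with \<open>\<Delta>(1)\<close>
  expanded in the tensors \<open>base i \<otimes> base j\<close>.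
\<close>

definition counit_t :: "complex \<Rightarrow> hybrid \<Rightarrow> hybrid" where
  "counit_t b h =
     (\<Sum>i\<in>UNIV. \<Sum>j\<in>UNIV. (comult b 1 i j * counit b (base i * h)) *\<^sub>C base j)"

definition left_integrals :: "complex \<Rightarrow> hybrid set" where
  "left_integrals b = {l. \<forall>x. x * l = counit_t b x * l}"

end

theory Submission
  imports Defs
begin

text \<open>
  Multiplying \<open>l = p + q g + r \<mu> + s \<nu>\<close> by \<open>\<mu>\<close> already gives all the information: the
  equation \<open>\<mu> l = \<epsilon>\<^sub>t(\<mu>) l\<close> amounts to \<open>b (p + s) = (1 + i b) q\<close> and
  \<open>b (2 r - q) = (1 + i b) (p - s)\<close>, and these two equations imply \<open>x l = \<epsilon>\<^sub>t(x) l\<close> for every \<open>x\<close>.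
  Solving them for \<open>r\<close> and \<open>s\<close> gives the two spanning vectors as the solutions with
  \<open>(p, q) = (1, 0)\<close> and \<open>(p, q) = (0, 1)\<close>.
\<close>

lemma all_hbasis: "(\<forall>k. P k) \<longleftrightarrow> P One \<and> P G \<and> P Mu \<and> P Nu"
  by (metis hbasis.exhaust)

lemma coord_one: "coord 1 k = (if k = One then 1 else 0)"
  by (simp add: one_hybrid_def coord_base)

lemma coord_mult_simps:
  "coord (x * y) One = coord x One * coord y One - coord x G * coord y G + coord x G * coord y Mu
     + coord x Mu * coord y G + coord x Nu * coord y Nu"
  "coord (x * y) G = coord x One * coord y G + coord x G * coord y One + coord x G * coord y Nu
     - coord x Nu * coord y G"
  "coord (x * y) Mu = coord x One * coord y Mu + coord x Mu * coord y One + coord x G * coord y Nu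
     - coord x Nu * coord y G - coord x Mu * coord y Nu + coord x Nu * coord y Mu"
  "coord (x * y) Nu = coord x One * coord y Nu + coord x Nu * coord y One - coord x G * coord y Mu
     + coord x Mu * coord y G"
  by (simp_all add: coord_mult UNIV_hbasis coord_base coord_one)

lemma counit_eq:
  "counit b x = 2 * coord x One + coord x G / b + 2 * b * coord x Mu + 2 * \<i> * b * coord x Nu"
  by (simp add: counit_def UNIV_hbasis)

lemma comult_one: "comult b 1 = comult_base b One"
proof -
  have "comult b 1 i j = comult_base b One i j" for i j
    unfolding comult_def
    by (simp add: UNIV_hbasis coord_one scale2_def)
  then show ?thesis by blast
qed

text \<open>With w = \<nu> - \<i> \<mu>, \<Delta>(1) = (1 \<otimes> 1 + w \<otimes> w) / 2, so
  \<open>counit_t b x\<close> is (\<epsilon>(x) 1 + \<epsilon>(w x) w) / 2. Hence the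
  \<open>G\<close> coordinate vanishes and the \<open>Mu\<close> coordinate is -\<i> times the
  \<open>Nu\<close> coordinate.\<close>

lemma coord_counit_t:
  "coord (counit_t b x) One =
     coord x One + coord x G / (2 * b) + b * coord x Mu + \<i> * b * coord x Nu"
  "coord (counit_t b x) G = 0"
  "coord (counit_t b x) Mu =
     (\<i> / (2 * b) - 1) * coord x G - \<i> * b * coord x Mu + (b - \<i>) * coord x Nu"
  "coord (counit_t b x) Nu =
     - (\<i> + 1 / (2 * b)) * coord x G + b * coord x Mu + (1 + \<i> * b) * coord x Nu"
  by (simp_all add: counit_t_def comult_one UNIV_hbasis coord_scale coord_base tensor_def scale2_def
      coord_one counit_eq coord_mult_simps)
    (simp_all add: algebra_simps add_divide_distrib diff_divide_distrib)

text \<open>The factors of \<open>coord l One\<close> and \<open>coord l G\<close> are written as in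
  the spanning vectors, so that comparing coordinates with a linear combination of those vectors
  yields this same pair of equations.\<close>

lemma left_integrals_iff:
  assumes "b \<noteq> 0"
  shows "l \<in> left_integrals b \<longleftrightarrow>
    coord l Mu = coord l One * (1 / b + \<i>)
      + coord l G * - ((1 - 2 * b * (b - \<i>)) / (2 * b\<^sup>2)) \<and>
    coord l Nu = coord l G * ((1 + \<i> * b) / b) - coord l One"
    (is "_ \<longleftrightarrow> ?mu \<and> ?nu")
proof
  assume "l \<in> left_integrals b"
  then have eq: "coord (\<mu> * l) k = coord (counit_t b \<mu> * l) k" for k
    by (simp add: left_integrals_def)
  have "b * (coord l One + coord l Nu) = (1 + \<i> * b) * coord l G"
    using eq[of One] by (simp add: coord_mult_simps coord_counit_t coord_base algebra_simps)
  then have nu: ?nu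
    using assms by (simp add: field_simps)
  have "b * (2 * coord l Mu - coord l G) = (1 + \<i> * b) * (coord l One - coord l Nu)"
    using eq[of Mu] by (simp add: coord_mult_simps coord_counit_t coord_base algebra_simps)
  then have "coord l Mu = coord l G / 2 + (1 + \<i> * b) / (2 * b) * (coord l One - coord l Nu)"
    using assms by (simp add: field_simps)
  \<comment> \<open>By \<open>nu\<close>, the factor of \<open>coord l G\<close> becomes 1/2 - (1 +
    \<i> b)^2 / (2 b^2).\<close>
  also have "\<dots> = coord l One * (1 / b + \<i>)
      + coord l G * - ((1 - 2 * b * (b - \<i>)) / (2 * b\<^sup>2))"
    unfolding nu using assms by (simp add: field_simps power2_eq_square)
  finally have ?mu .
  with nu show "?mu \<and> ?nu" by blast
next
  assume "?mu \<and> ?nu"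
  then have mu: ?mu and nu: ?nu by auto
  have "x * l = counit_t b x * l" for x
    unfolding hybrid_eq_iff all_hbasis coord_mult_simps coord_counit_t mu nu
    using assms by (simp add: field_simps power2_eq_square)
  then show "l \<in> left_integrals b"
    by (simp add: left_integrals_def)
qed

theorem theorem4p1:
  fixes b :: complex
  assumes "b \<noteq> 0"
  shows "left_integrals b =
    hybrid.span
      {(1 / b + \<i>) *\<^sub>C \<mu> - \<nu> + 1,
       - ((1 - 2 * b * (b - \<i>)) / (2 * b\<^sup>2)) *\<^sub>C \<mu> + ((1 + \<i> * b) / b) *\<^sub>C \<nu> + g}"
    (is "_ = hybrid.span {?u, ?v}")
proof (intro set_eqI)
  fix l
  have u: "coord ?u One = 1" "coord ?u G = 0" "coord ?u Mu = 1 / b + \<i>" "coord ?u Nu = - 1"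
    and v: "coord ?v One = 0" "coord ?v G = 1"
      "coord ?v Mu = - ((1 - 2 * b * (b - \<i>)) / (2 * b\<^sup>2))" "coord ?v Nu = (1 + \<i> * b) / b"
    by (simp_all add: coord_scale coord_base coord_one)
  have lin: "coord (p *\<^sub>C ?u + q *\<^sub>C ?v) k = p * coord ?u k + q * coord ?v k" for p q k
    by (simp only: coord_add_group(2) coord_scale)
  have "l \<in> hybrid.span {?u, ?v} \<longleftrightarrow> (\<exists>p q. l = p *\<^sub>C ?u + q *\<^sub>C ?v)"
    by (auto simp: hybrid.span_insert hybrid.span_empty diff_eq_eq add.commute)
  \<comment> \<open>At \<open>One\<close> and \<open>G\<close> the vectors \<open>?u\<close> and
    \<open>?v\<close> have coordinates (1, 0) and (0, 1), which forces p and q to be the coordinates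
    of \<open>l\<close> there.\<close>
  also have "\<dots> \<longleftrightarrow> l = coord l One *\<^sub>C ?u + coord l G *\<^sub>C ?v"
    by (metis (no_types, lifting) add_0 add.right_neutral coord_add_group(2) coord_scale mult.right_neutral
        mult_zero_right u(1,2) v(1,2))
  also have "\<dots> \<longleftrightarrow> l \<in> left_integrals b"
    unfolding left_integrals_iff[OF assms] hybrid_eq_iff all_hbasis lin u v
    by simp
  finally show "l \<in> left_integrals b \<longleftrightarrow> l \<in> hybrid.span {?u, ?v}" ..
qed

end
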